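(* For all $T>0$ and $r\ge1$ there exists a constant $C=C(T,r,Y_0,k,a,\sigma,H)<\infty$ such that for all $\varepsilon>0$ and $t\in[0,T]$: $$\mathbb E|Y_\varepsilon(t)|^r<C.$$
   Context: $B^H=\{B^H(t),t\ge0\}$ is a fractional Brownian motion with Hurst index $H\in(0,1)$ on a probability space $(\Omega,\mathcal F,\mathbb P)$, i.e. a centered Gaussian process with covariance $\mathbb E[B^H(t)B^H(s)]=\frac12(t^{2H}+s^{2H}-|t-s|^{2H})$ and continuous paths starting at $0$. $Y_0,k,a,\sigma>0$ are constants. For $\varepsilon>0$, $Y_\varepsilon=\{Y_\varepsilon(t),t\ge0\}$ is the unique (pathwise, continuous) solution of $$Y_\varepsilon(t)=Y_0+\int_0^t\frac{k}{Y_\varepsilon(s)\mathbf 1_{\{Y_\varepsilon(s)>0\}}+\varepsilon}\,ds-a\int_0^tY_\varepsilon(s)\,ds+\sigma B^H(t),\quad t\ge0.$$ *)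

theory Defs
  imports "HOL-Probability.Probability"
begin

text \<open>Constants count as (degenerate) Gaussian random variables.\<close>

definition gaussian_rv :: "'w measure \<Rightarrow> ('w \<Rightarrow> real) \<Rightarrow> bool" where
  "gaussian_rv M X \<longleftrightarrow> X \<in> borel_measurable M \<and>
     ((\<exists>\<mu>. AE \<omega> in M. X \<omega> = \<mu>) \<or>
      (\<exists>\<mu> s. 0 < s \<and> distributed M lborel X (\<lambda>x. ennreal (normal_density \<mu> s x))))"

text \<open>Processes are indexed by \<open>t \<ge> 0\<close>; their values at negative times are irrelevant.
  Joint Gaussianity of the finite-dimensional distributions is expressed by Gaussianity of all
  finite linear combinations.\<close>

definition gaussian_process :: "'w measure \<Rightarrow> (real \<Rightarrow> 'w \<Rightarrow> real) \<Rightarrow> bool" where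
  "gaussian_process M X \<longleftrightarrow>
     (\<forall>I c. finite I \<and> I \<subseteq> {0..} \<longrightarrow> gaussian_rv M (\<lambda>\<omega>. \<Sum>t\<in>I. c t * X t \<omega>))"

definition fractional_brownian_motion ::
    "'w measure \<Rightarrow> real \<Rightarrow> (real \<Rightarrow> 'w \<Rightarrow> real) \<Rightarrow> bool" where
  "fractional_brownian_motion M H B \<longleftrightarrow>
     prob_space M \<and> 0 < H \<and> H < 1 \<and>
     gaussian_process M B \<and>
     (\<forall>t\<ge>0. (\<integral>\<omega>. B t \<omega> \<partial>M) = 0) \<and>
     (\<forall>t\<ge>0. \<forall>s\<ge>0. (\<integral>\<omega>. B t \<omega> * B s \<omega> \<partial>M) =
        (t powr (2 * H) + s powr (2 * H) - \<bar>t - s\<bar> powr (2 * H)) / 2) \<and>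
     (\<forall>\<omega>\<in>space M. B 0 \<omega> = 0 \<and> continuous_on {0..} (\<lambda>t. B t \<omega>))"

text \<open>The equation is understood pathwise, for every \<open>\<omega>\<close>. Along continuous paths
  both integrands are continuous, so the integrals are ordinary Riemann integrals.\<close>

definition approx_solution ::
    "'w measure \<Rightarrow> (real \<Rightarrow> 'w \<Rightarrow> real) \<Rightarrow> real \<Rightarrow> real \<Rightarrow> real \<Rightarrow> real \<Rightarrow> real
      \<Rightarrow> (real \<Rightarrow> 'w \<Rightarrow> real) \<Rightarrow> bool" where
  "approx_solution M B Y0 k a \<sigma> \<epsilon> Y \<longleftrightarrow>
     (\<forall>t\<ge>0. Y t \<in> borel_measurable M) \<and>
     (\<forall>\<omega>\<in>space M. continuous_on {0..} (\<lambda>t. Y t \<omega>) \<and>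
        (\<forall>t\<ge>0. Y t \<omega> = Y0
           + integral {0..t} (\<lambda>s. k / (Y s \<omega> * indicat_real {0<..} (Y s \<omega>) + \<epsilon>))
           - a * integral {0..t} (\<lambda>s. Y s \<omega>) + \<sigma> * B t \<omega>))"

end

theory Submission
  imports Defs
begin

text \<open>
  Pathwise, \<open>Y\<^sub>\<epsilon>\<close> is controlled by the running supremum of \<open>\<bar>B\<bar>\<close> uniformly in \<open>\<epsilon>\<close>. If
  \<open>Y(t) > Y\<^sub>0\<close>, start at the last time \<open>\<tau>\<close> before \<open>t\<close> with \<open>Y(\<tau>) = Y\<^sub>0\<close>: on \<open>[\<tau>, t]\<close> the singular
  drift is at most \<open>k / Y\<^sub>0\<close> and the linear drift is negative. If \<open>Y(t) < 0\<close>, start at the last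
  zero: from then on both drifts are nonnegative. Hence
  \<open>\<bar>Y(t)\<bar> \<le> Y\<^sub>0 + k T / Y\<^sub>0 + 2 \<sigma> sup \<bar>B\<bar>\<close>.

  Moments of the supremum come from dyadic chaining. The centered Gaussian increments have
  \<open>2m\<close>-th moments proportional to \<open>\<bar>t - s\<bar>\<^sup>2\<^sup>m\<^sup>H\<close>, so for \<open>m H > 1\<close> a suitably weighted sum \<open>U\<close> of
  the \<open>2m\<close>-th powers of all dyadic increments is integrable, and \<open>\<bar>B\<bar>\<close> is bounded by a constant
  times \<open>U\<close> to the power \<open>1 / 2m\<close>.
\<close>

section \<open>Dyadic chaining along a single path\<close>

text \<open>A point of level \<open>n + 1\<close> with even index already lies in level
  \<open>n\<close>, and one with odd index is a single increment away from its left neighbour, which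
  does. Descending through the levels therefore costs at most \<open>A * \<rho> ^ i\<close> at level
  \<open>i\<close>, a geometric series in total. Density of the dyadic points and continuity then
  give every \<open>t\<close>.\<close>

lemma dyadic_bound:
  fixes f :: "real \<Rightarrow> real"
  assumes "0 < T" "0 \<le> A" "0 \<le> \<rho>" "\<rho> < 1"
    and cont: "continuous_on {0..T} f" and f0: "f 0 = 0"
    and incr: "\<And>n j. j < 2 ^ n \<Longrightarrow>
      \<bar>f (T * real (Suc j) / 2 ^ n) - f (T * real j / 2 ^ n)\<bar> \<le> A * \<rho> ^ n"
    and t: "t \<in> {0..T}"
  shows "\<bar>f t\<bar> \<le> A / (1 - \<rho>)"
proof -
  have partial: "\<bar>f (T * real j / 2 ^ n)\<bar> \<le> A * (\<Sum>i\<le>n. \<rho> ^ i)" if "j \<le> 2 ^ n" for n j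
    using that
  proof (induction n arbitrary: j)
    case 0
    \<comment> \<open>Level 0 consists of 0 and \<open>T\<close> and has one increment of its own,
      which is why the sum starts at \<open>i = 0\<close>.\<close>
    then have "j = 0 \<or> j = 1" by auto
    then show ?case
      using f0 incr[of 0 0] \<open>0 \<le> A\<close> by auto
  next
    case (Suc n)
    have even_case: "\<bar>f (T * real (2 * i) / 2 ^ Suc n)\<bar> \<le> A * (\<Sum>i\<le>n. \<rho> ^ i)"
      if "2 * i \<le> 2 ^ Suc n" for i
      using Suc.IH[of i] that by simp
    have nonneg: "0 \<le> A * \<rho> ^ Suc n"
      using assms by simp
    have split: "A * (\<Sum>i\<le>Suc n. \<rho> ^ i) = A * (\<Sum>i\<le>n. \<rho> ^ i) + A * \<rho> ^ Suc n"
      by (simp add: algebra_simps)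
    show ?case
    proof (cases "even j")
      case True
      then obtain i where "j = 2 * i" by blast
      then show ?thesis
        using even_case[of i] Suc.prems nonneg split by (metis add_increasing2 order.trans)
    next
      case False
      then obtain i where i: "j = Suc (2 * i)" by (metis oddE Suc_eq_plus1)
      then show ?thesis
        using even_case[of i] Suc.prems incr[of "2 * i" "Suc n"] unfolding i split by linarith
    qed
  qed
  have dyadic: "\<bar>f (T * real j / 2 ^ n)\<bar> \<le> A / (1 - \<rho>)" if "j \<le> 2 ^ n" for n j
  proof -
    have "(\<Sum>i\<le>n. \<rho> ^ i) \<le> (\<Sum>i. \<rho> ^ i)"
      using assms by (intro sum_le_suminf) auto
    also have "\<dots> = 1 / (1 - \<rho>)"
      using assms by (intro suminf_geometric) auto
    finally have "A * (\<Sum>i\<le>n. \<rho> ^ i) \<le> A * (1 / (1 - \<rho>))"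
      using \<open>0 \<le> A\<close> by (rule mult_left_mono)
    with partial[OF that] show ?thesis by simp
  qed
  \<comment> \<open>\<open>s n\<close> is the largest dyadic point of level \<open>n\<close> not
    exceeding \<open>t\<close>; it lags behind \<open>t\<close> by at most
    \<open>T / 2 ^ n\<close>.\<close>
  define s where "s n = T * real (nat \<lfloor>t / T * 2 ^ n\<rfloor>) / 2 ^ n" for n :: nat
  have tT: "0 \<le> t / T" "t / T \<le> 1"
    using t \<open>0 < T\<close> by auto
  have s_eq: "s n = T * (real_of_int \<lfloor>t / T * 2 ^ n\<rfloor> / 2 ^ n)" for n
    unfolding s_def using t \<open>0 < T\<close> by (subst of_nat_nat) auto
  have le: "nat \<lfloor>t / T * 2 ^ n\<rfloor> \<le> 2 ^ n" for n
  proof -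
    have "t / T * 2 ^ n \<le> 1 * 2 ^ n"
      using tT by (intro mult_right_mono) auto
    then have "\<lfloor>t / T * 2 ^ n\<rfloor> \<le> 2 ^ n"
      by (simp add: floor_le_iff)
    then show ?thesis by simp
  qed
  have s_bounds: "s n \<le> t" "t - T * (1 / 2) ^ n \<le> s n" for n
  proof -
    define F where "F = real_of_int \<lfloor>t / T * 2 ^ n\<rfloor>"
    have F: "F \<le> t / T * 2 ^ n" "t / T * 2 ^ n - 1 \<le> F"
      unfolding F_def by linarith+
    have "F / 2 ^ n \<le> t / T * 2 ^ n / 2 ^ n" "(t / T * 2 ^ n - 1) / 2 ^ n \<le> F / 2 ^ n"
      by (rule divide_right_mono[OF F(1)], simp) (rule divide_right_mono[OF F(2)], simp)
    moreover have "(t / T * 2 ^ n - 1) / 2 ^ n = t / T - (1 / 2) ^ n"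
      by (simp add: diff_divide_distrib power_one_over)
    moreover have "t / T * 2 ^ n / 2 ^ n = t / T"
      by simp
    ultimately have "T * (F / 2 ^ n) \<le> T * (t / T)" "T * (t / T - (1 / 2) ^ n) \<le> T * (F / 2 ^ n)"
      using \<open>0 < T\<close> by (simp_all only: mult_le_cancel_left_pos)
    then show "s n \<le> t" "t - T * (1 / 2) ^ n \<le> s n"
      unfolding s_eq F_def[symmetric] using \<open>0 < T\<close> by (simp_all add: right_diff_distrib)
  qed
  have half: "(\<lambda>n. (1 / 2 :: real) ^ n) \<longlonglongrightarrow> 0"
    by (rule LIMSEQ_realpow_zero) auto
  have "(\<lambda>n. t - T * (1 / 2) ^ n) \<longlonglongrightarrow> t - T * 0"
    by (rule tendsto_diff[OF tendsto_const tendsto_mult[OF tendsto_const half]])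
  then have "s \<longlonglongrightarrow> t"
    using tendsto_sandwich[of "\<lambda>n. t - T * (1 / 2) ^ n" s sequentially "\<lambda>_. t" t] s_bounds by auto
  moreover have "s n \<in> {0..T}" for n
    using s_bounds(1)[of n] t \<open>0 < T\<close> by (auto simp: s_def)
  ultimately have "(\<lambda>n. f (s n)) \<longlonglongrightarrow> f t"
    using continuous_on_tendsto_compose[OF cont, of s t sequentially] t by auto
  then have "(\<lambda>n. \<bar>f (s n)\<bar>) \<longlonglongrightarrow> \<bar>f t\<bar>"
    by (rule tendsto_rabs)
  then show ?thesis
    using dyadic[OF le] by (intro LIMSEQ_le_const2[of "\<lambda>n. \<bar>f (s n)\<bar>"]) (auto simp: s_def)
qed

section \<open>Pathwise bound for the solution, uniform in \<epsilon>\<close>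

text \<open>The time \<open>\<tau>\<close> is the maximum of the compact set where \<open>y\<close>
  is at most \<open>c\<close>, so the path stays above \<open>c\<close> afterwards.\<close>

lemma last_crossing:
  fixes y :: "real \<Rightarrow> real"
  assumes "0 \<le> t" and cont: "continuous_on {0..t} y" and "y 0 \<le> c" "c < y t"
  obtains \<tau> where "0 \<le> \<tau>" "\<tau> < t" "y \<tau> = c" "\<And>s. \<lbrakk>\<tau> < s; s \<le> t\<rbrakk> \<Longrightarrow> c < y s"
proof -
  define L where "L = {s \<in> {0..t}. y s \<le> c}"
  have "compact L"
  proof -
    have "closed L"
      using continuous_closed_preimage[OF cont, of "{..c}"] by (simp add: L_def vimage_def Int_def)
    moreover have "bounded L"
      unfolding L_def by (rule bounded_subset[of "{0..t}"]) auto
    ultimately show ?thesis by (simp add: compact_eq_bounded_closed)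
  qed
  moreover have "L \<noteq> {}"
    using assms by (auto simp: L_def)
  ultimately obtain \<tau> where \<tau>: "\<tau> \<in> L" "\<And>s. s \<in> L \<Longrightarrow> s \<le> \<tau>"
    using compact_attains_sup[of L] by blast
  have after: "c < y s" if "\<tau> < s" "s \<le> t" for s
    using \<tau>(1) \<tau>(2)[of s] that by (force simp: L_def)
  have "\<tau> < t"
    using \<tau>(1) \<open>c < y t\<close> by (cases "\<tau> = t") (auto simp: L_def)
  moreover have "y \<tau> = c"
  proof -
    \<comment> \<open>Membership in \<open>L\<close> gives only \<open>y \<tau> \<le> c\<close>. The
      intermediate value theorem yields a point of \<open>{\<tau>..t}\<close> with value
      \<open>c\<close>, and by \<open>after\<close> this point can only be
      \<open>\<tau>\<close>.\<close>
    have "\<exists>s\<ge>\<tau>. s \<le> t \<and> y s = c"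
      using \<tau>(1) \<open>c < y t\<close> by (intro IVT') (auto simp: L_def intro: continuous_on_subset[OF cont])
    then obtain s where "\<tau> \<le> s" "s \<le> t" "y s = c" by blast
    then show ?thesis using after[of s] by (cases "s = \<tau>") auto
  qed
  ultimately show ?thesis
    using that \<tau>(1) after by (auto simp: L_def)
qed

lemma solution_bound:
  fixes y b :: "real \<Rightarrow> real"
  assumes pos: "0 < Y0" "0 < k" "0 < a" "0 < \<sigma>" "0 < \<epsilon>"
    and cont: "continuous_on {0..} y"
    and eq: "\<And>t. 0 \<le> t \<Longrightarrow> y t = Y0
           + integral {0..t} (\<lambda>s. k / (y s * indicat_real {0<..} (y s) + \<epsilon>))
           - a * integral {0..t} y + \<sigma> * b t"
    and b0: "b 0 = 0"
    and b: "\<And>t. t \<in> {0..T} \<Longrightarrow> \<bar>b t\<bar> \<le> S"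
    and t: "t \<in> {0..T}"
  shows "\<bar>y t\<bar> \<le> Y0 + k * T / Y0 + 2 * \<sigma> * S"
proof -
  define g where "g s = k / (y s * indicat_real {0<..} (y s) + \<epsilon>)" for s
  \<comment> \<open>The indicator jumps at 0, but its product with \<open>y s\<close> is a positive
    part; in this form the denominator is visibly continuous and at least \<epsilon>.\<close>
  have g_max: "g s = k / (max (y s) 0 + \<epsilon>)" for s
    by (auto simp: g_def indicator_def max_def)
  have cont_g: "continuous_on {0..} g"
    unfolding g_max[abs_def] using cont pos
    by (intro continuous_intros) (auto simp: add_nonneg_pos less_imp_neq[symmetric] max_def)
  have int: "g integrable_on {u..v}" "y integrable_on {u..v}" if "0 \<le> u" for u v
    using that by (auto intro!: integrable_continuous_interval
        intro: continuous_on_subset[OF cont_g] continuous_on_subset[OF cont])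
  \<comment> \<open>Subtracting the equation at two times lets the estimates start at a crossing
    time instead of 0.\<close>
  have increment: "y v - y u = integral {u..v} g - a * integral {u..v} y + \<sigma> * (b v - b u)"
    if "0 \<le> u" "u \<le> v" for u v
  proof -
    have "integral {0..u} g + integral {u..v} g = integral {0..v} g"
      "integral {0..u} y + integral {u..v} y = integral {0..v} y"
      using that int[of 0 v] by (auto intro!: Henstock_Kurzweil_Integration.integral_combine)
    then have split: "integral {u..v} g = integral {0..v} g - integral {0..u} g"
      "integral {u..v} y = integral {0..v} y - integral {0..u} y"
      by linarith+
    have "0 \<le> v" using that by linarith
    show ?thesis
      unfolding eq[OF \<open>0 \<le> u\<close>, folded g_def] eq[OF \<open>0 \<le> v\<close>, folded g_def] split
      by (simp add: algebra_simps)
  qed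
  have b_diff: "\<sigma> * (b v - b u) \<le> 2 * \<sigma> * S" "- (2 * \<sigma> * S) \<le> \<sigma> * (b v - b u)"
    if "u \<in> {0..T}" "v \<in> {0..T}" for u v
  proof -
    have "\<bar>b v - b u\<bar> \<le> 2 * S" using b[OF that(1)] b[OF that(2)] by linarith
    then have "\<sigma> * \<bar>b v - b u\<bar> \<le> \<sigma> * (2 * S)"
      using pos by (intro mult_left_mono) auto
    then have "\<bar>\<sigma> * (b v - b u)\<bar> \<le> 2 * \<sigma> * S" using pos by (simp add: abs_mult)
    then show "\<sigma> * (b v - b u) \<le> 2 * \<sigma> * S" "- (2 * \<sigma> * S) \<le> \<sigma> * (b v - b u)" by linarith+
  qed
  have y0: "y 0 = Y0" using eq[of 0] b0 by simp
  have "0 \<le> S" using b[OF t] by linarith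
  then have S: "0 \<le> 2 * \<sigma> * S" using pos by simp
  have kT: "0 \<le> k * T / Y0" using pos t by simp
  have cont_t: "continuous_on {0..t} y" by (rule continuous_on_subset[OF cont]) auto
  have "y t \<le> Y0 + k * T / Y0 + 2 * \<sigma> * S"
  proof (cases "y t \<le> Y0")
    case True
    then show ?thesis using S kT by linarith
  next
    case False
    have "0 \<le> t" "y 0 \<le> Y0" "Y0 < y t" using t y0 False by auto
    then obtain \<tau> where \<tau>: "0 \<le> \<tau>" "\<tau> < t" "y \<tau> = Y0" "\<And>s. \<lbrakk>\<tau> < s; s \<le> t\<rbrakk> \<Longrightarrow> Y0 < y s"
      using last_crossing[OF _ cont_t] by blast
    have ge: "Y0 \<le> y s" if "s \<in> {\<tau>..t}" for s
      using \<tau>(3) \<tau>(4)[of s] that by (cases "s = \<tau>") (auto intro: less_imp_le)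
    \<comment> \<open>Here \<epsilon> disappears: on \<open>{\<tau>..t}\<close> the denominator is
      at least \<open>Y0 + \<epsilon>\<close>, hence at least \<open>Y0\<close>.\<close>
    have "integral {\<tau>..t} g \<le> integral {\<tau>..t} (\<lambda>_. k / Y0)"
    proof (rule integral_le)
      fix s assume "s \<in> {\<tau>..t}"
      from ge[OF this] show "g s \<le> k / Y0"
        unfolding g_max using pos by (intro divide_left_mono) (auto simp: max_def)
    qed (use int \<tau> in auto)
    also have "\<dots> = k * (t - \<tau>) / Y0" using \<tau> by simp
    also have "\<dots> \<le> k * T / Y0"
      using pos \<tau> t by (intro divide_right_mono mult_left_mono) auto
    finally have "integral {\<tau>..t} g \<le> k * T / Y0" .
    moreover have "0 \<le> integral {\<tau>..t} y"
    proof (rule Henstock_Kurzweil_Integration.integral_nonneg)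
      fix s assume "s \<in> {\<tau>..t}"
      from ge[OF this] show "0 \<le> y s" using pos by linarith
    qed (use int \<tau> in auto)
    then have "0 \<le> a * integral {\<tau>..t} y" using pos by simp
    moreover have "\<sigma> * (b t - b \<tau>) \<le> 2 * \<sigma> * S" using b_diff[of \<tau> t] \<tau> t by auto
    ultimately show ?thesis using increment[of \<tau> t] \<tau> by linarith
  qed
  moreover have "- (2 * \<sigma> * S) \<le> y t"
  proof (cases "0 \<le> y t")
    case True
    then show ?thesis using S by linarith
  next
    case False
    \<comment> \<open>An excursion of \<open>y\<close> below 0 is an excursion of \<open>- y\<close>
      above 0, so the same crossing lemma applies.\<close>
    have "0 \<le> t" "- y 0 \<le> 0" "0 < - y t" using t y0 pos False by auto
    then obtain \<tau> where \<tau>: "0 \<le> \<tau>" "\<tau> < t" "- y \<tau> = 0" "\<And>s. \<lbrakk>\<tau> < s; s \<le> t\<rbrakk> \<Longrightarrow> 0 < - y s"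
      using last_crossing[OF _ continuous_on_minus[OF cont_t]] by blast
    have "0 \<le> integral {\<tau>..t} g"
      using pos \<tau> int[of \<tau> t] by (intro Henstock_Kurzweil_Integration.integral_nonneg) (auto simp: g_max)
    moreover have "0 \<le> integral {\<tau>..t} (\<lambda>s. - y s)"
    proof (rule Henstock_Kurzweil_Integration.integral_nonneg)
      fix s assume "s \<in> {\<tau>..t}"
      then show "0 \<le> - y s"
        using \<tau>(3) \<tau>(4)[of s] by (cases "s = \<tau>") (auto intro: less_imp_le)
    qed (use int \<tau> in \<open>auto intro: integrable_neg\<close>)
    then have "a * integral {\<tau>..t} y \<le> 0" using pos by (simp add: mult_le_0_iff)
    moreover have "- (2 * \<sigma> * S) \<le> \<sigma> * (b t - b \<tau>)" using b_diff[of \<tau> t] \<tau> t by auto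
    ultimately show ?thesis using increment[of \<tau> t] \<tau> by linarith
  qed
  ultimately show ?thesis using S kT pos by linarith
qed

section \<open>Moments of Gaussian variables\<close>

lemma gaussian_rv_measurable: "gaussian_rv M X \<Longrightarrow> X \<in> borel_measurable M"
  by (simp add: gaussian_rv_def)

text \<open>An almost surely constant variable is essentially bounded. For a nondegenerate normal
  law, the binomial expansion of \<open>((x - \<mu>) + \<mu>) ^ n\<close> reduces the claim to
  central moments.\<close>

lemma gaussian_rv_integrable_power:
  assumes "prob_space M" "gaussian_rv M X"
  shows "integrable M (\<lambda>\<omega>. X \<omega> ^ n)"
proof -
  interpret prob_space M by fact
  have [measurable]: "X \<in> borel_measurable M"
    by (rule gaussian_rv_measurable[OF assms(2)])
  from assms(2) consider (const) \<mu> where "AE \<omega> in M. X \<omega> = \<mu>"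
    | (normal) \<mu> s where "0 < s" "distributed M lborel X (\<lambda>x. ennreal (normal_density \<mu> s x))"
    by (auto simp: gaussian_rv_def)
  then show ?thesis
  proof cases
    case const
    then have "AE \<omega> in M. norm (X \<omega> ^ n) \<le> \<bar>\<mu>\<bar> ^ n"
      by eventually_elim (simp add: power_abs)
    then show ?thesis
      by (intro integrable_const_bound) auto
  next
    case normal
    have "normal_density \<mu> s x * (real (n choose i) * (x - \<mu>) ^ i * \<mu> ^ (n - i))
      = real (n choose i) * \<mu> ^ (n - i) * (normal_density \<mu> s x * (x - \<mu>) ^ i)" for x i
      by simp
    then have "integrable lborel (\<lambda>x. normal_density \<mu> s x * ((x - \<mu>) + \<mu>) ^ n)"
      unfolding binomial_ring sum_distrib_left
      using Bochner_Integration.integrable_mult_right[OF integrable_normal_moment[OF normal(1), of \<mu>]]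
      by (intro Bochner_Integration.integrable_sum) (simp only:)
    then show ?thesis
      using distributed_integrable[OF normal(2), of "\<lambda>x. x ^ n"] by simp
  qed
qed

text \<open>The factor is the double factorial (2m-1)!!, the moment of order \<open>2 * m\<close> of
  a standard normal variable. Measuring the scale by the second moment lets one formula cover the
  degenerate case too, where both sides vanish.\<close>

lemma gaussian_rv_centered_moment:
  assumes "prob_space M" "gaussian_rv M X" "(\<integral>\<omega>. X \<omega> \<partial>M) = 0" "0 < m"
  shows "(\<integral>\<omega>. X \<omega> ^ (2 * m) \<partial>M) = fact (2 * m) / (2 ^ m * fact m) * (\<integral>\<omega>. (X \<omega>)\<^sup>2 \<partial>M) ^ m"
proof -
  interpret prob_space M by fact
  have [measurable]: "X \<in> borel_measurable M"
    by (rule gaussian_rv_measurable[OF assms(2)])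
  from assms(2) consider (const) \<mu> where "AE \<omega> in M. X \<omega> = \<mu>"
    | (normal) \<mu> s where "0 < s" "distributed M lborel X (\<lambda>x. ennreal (normal_density \<mu> s x))"
    by (auto simp: gaussian_rv_def)
  then show ?thesis
  proof cases
    case const
    then have "(\<integral>\<omega>. X \<omega> \<partial>M) = (\<integral>\<omega>. \<mu> \<partial>M)"
      by (intro integral_cong_AE) auto
    with assms(3) have "\<mu> = 0" by (simp add: prob_space)
    with const have X0: "AE \<omega> in M. X \<omega> = 0" by simp
    have zero: "(\<integral>\<omega>. X \<omega> ^ n \<partial>M) = 0" if "0 < n" for n
    proof -
      have "(\<integral>\<omega>. X \<omega> ^ n \<partial>M) = (\<integral>\<omega>. 0 \<partial>M)"
        using X0 that by (intro integral_cong_AE) auto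
      then show ?thesis by simp
    qed
    show ?thesis using zero[of "2 * m"] zero[of 2] \<open>0 < m\<close> by simp
  next
    case normal
    then have "\<mu> = 0"
      using normal_distributed_expectation[of s X \<mu>] assms(3) by simp
    have moment: "(\<integral>\<omega>. X \<omega> ^ (2 * k) \<partial>M) = fact (2 * k) / ((2 / s\<^sup>2) ^ k * fact k)" for k
      using distributed_integral[OF normal(2), of "\<lambda>x. x ^ (2 * k)", symmetric]
        integral_normal_moment_even[OF normal(1), of \<mu> k] \<open>\<mu> = 0\<close> by simp
    \<comment> \<open>The case \<open>k = 1\<close> identifies the second moment, through which the
      moment of order \<open>2 * m\<close> is then expressed.\<close>
    have "(\<integral>\<omega>. (X \<omega>)\<^sup>2 \<partial>M) = s\<^sup>2"
      using moment[of 1] by (simp add: fact_2)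
    then show ?thesis
      using moment[of m] by (simp add: power_divide)
  qed
qed

section \<open>Increments of fractional Brownian motion\<close>

lemma fbm_gaussian:
  assumes "fractional_brownian_motion M H B" "0 \<le> t"
  shows "gaussian_rv M (B t)"
proof -
  have "gaussian_rv M (\<lambda>\<omega>. \<Sum>u\<in>{t}. 1 * B u \<omega>)"
    using assms unfolding fractional_brownian_motion_def gaussian_process_def
    by (elim conjE allE[of _ "{t}"] allE[of _ "\<lambda>_. 1"]) auto
  then show ?thesis by simp
qed

lemma fbm_increment_gaussian:
  assumes fbm: "fractional_brownian_motion M H B" and "0 \<le> s" "0 \<le> t" "s \<noteq> t"
  shows "gaussian_rv M (\<lambda>\<omega>. B t \<omega> - B s \<omega>)"
proof -
  \<comment> \<open>Since \<open>s \<noteq> t\<close>, the index set has two elements and both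
    coefficients, 1 at \<open>t\<close> and -1 at \<open>s\<close>, really occur.\<close>
  have "gaussian_rv M (\<lambda>\<omega>. \<Sum>u\<in>{s, t}. (if u = t then 1 else - 1) * B u \<omega>)"
    using assms unfolding fractional_brownian_motion_def gaussian_process_def
    by (elim conjE allE[of _ "{s, t}"] allE[of _ "\<lambda>u. if u = t then 1 else - 1"]) auto
  moreover have "(\<lambda>\<omega>. \<Sum>u\<in>{s, t}. (if u = t then 1 else - 1) * B u \<omega>) = (\<lambda>\<omega>. B t \<omega> - B s \<omega>)"
    using \<open>s \<noteq> t\<close> by auto
  ultimately show ?thesis by metis
qed

text \<open>Expanding the square and inserting the covariance gives the increment the variance
  \<open>\<bar>t - s\<bar> powr (2 * H)\<close>; the centered moment formula does the rest.\<close>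

lemma fbm_increment_moment:
  assumes fbm: "fractional_brownian_motion M H B" and "0 \<le> s" "0 \<le> t" "s \<noteq> t" "0 < m"
  shows "integrable M (\<lambda>\<omega>. (B t \<omega> - B s \<omega>) ^ (2 * m))"
    and "(\<integral>\<omega>. (B t \<omega> - B s \<omega>) ^ (2 * m) \<partial>M)
      = fact (2 * m) / (2 ^ m * fact m) * \<bar>t - s\<bar> powr (2 * real m * H)"
proof -
  have ps: "prob_space M" using fbm by (simp add: fractional_brownian_motion_def)
  note incr = fbm_increment_gaussian[OF fbm \<open>0 \<le> s\<close> \<open>0 \<le> t\<close> \<open>s \<noteq> t\<close>]
  show "integrable M (\<lambda>\<omega>. (B t \<omega> - B s \<omega>) ^ (2 * m))"
    by (rule gaussian_rv_integrable_power[OF ps incr])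
  have cov: "(\<integral>\<omega>. B u \<omega> * B v \<omega> \<partial>M) = (u powr (2 * H) + v powr (2 * H) - \<bar>u - v\<bar> powr (2 * H)) / 2"
    if "0 \<le> u" "0 \<le> v" for u v
    using fbm that by (simp add: fractional_brownian_motion_def)
  have int: "integrable M (B u)" and sq: "integrable M (\<lambda>\<omega>. (B u \<omega>)\<^sup>2)" if "0 \<le> u" for u
    using gaussian_rv_integrable_power[OF ps fbm_gaussian[OF fbm that], of 1]
      gaussian_rv_integrable_power[OF ps fbm_gaussian[OF fbm that], of 2] by simp_all
  have sq_incr: "integrable M (\<lambda>\<omega>. (B t \<omega> - B s \<omega>)\<^sup>2)"
    using gaussian_rv_integrable_power[OF ps incr] .
  \<comment> \<open>Polarization makes the product integrable, since all three squares belong to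
    Gaussian variables. Linearity of the integral needs this below.\<close>
  have mixed_eq: "B t \<omega> * B s \<omega> = ((B t \<omega>)\<^sup>2 + (B s \<omega>)\<^sup>2 - (B t \<omega> - B s \<omega>)\<^sup>2) / 2" for \<omega>
    by (simp add: power2_eq_square algebra_simps)
  have mixed: "integrable M (\<lambda>\<omega>. B t \<omega> * B s \<omega>)"
    unfolding mixed_eq using sq sq_incr assms by auto
  have mean: "(\<integral>\<omega>. B t \<omega> - B s \<omega> \<partial>M) = 0"
    using int assms fbm by (simp add: fractional_brownian_motion_def)
  have "(\<integral>\<omega>. (B t \<omega> - B s \<omega>)\<^sup>2 \<partial>M)
    = (\<integral>\<omega>. (B t \<omega>)\<^sup>2 + (B s \<omega>)\<^sup>2 - 2 * (B t \<omega> * B s \<omega>) \<partial>M)"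
    by (simp add: power2_diff mult.assoc)
  also have "\<dots> = (\<integral>\<omega>. (B t \<omega>)\<^sup>2 \<partial>M) + (\<integral>\<omega>. (B s \<omega>)\<^sup>2 \<partial>M) - 2 * (\<integral>\<omega>. B t \<omega> * B s \<omega> \<partial>M)"
    using sq mixed assms by simp
  also have "\<dots> = \<bar>t - s\<bar> powr (2 * H)"
    using cov[of t t] cov[of s s] cov[of t s] assms by (simp add: power2_eq_square)
  finally have "(\<integral>\<omega>. (B t \<omega> - B s \<omega>)\<^sup>2 \<partial>M) = \<bar>t - s\<bar> powr (2 * H)" .
  moreover have "(\<bar>t - s\<bar> powr (2 * H)) ^ m = \<bar>t - s\<bar> powr (2 * real m * H)"
    using \<open>s \<noteq> t\<close> by (simp add: powr_powr mult_ac flip: powr_realpow)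
  ultimately show "(\<integral>\<omega>. (B t \<omega> - B s \<omega>) ^ (2 * m) \<partial>M)
      = fact (2 * m) / (2 ^ m * fact m) * \<bar>t - s\<bar> powr (2 * real m * H)"
    using gaussian_rv_centered_moment[OF ps incr mean \<open>0 < m\<close>] by simp
qed

section \<open>Moments of a bound for the running supremum\<close>

text \<open>The moment of \<open>S\<close> is computed exactly to show that it depends on
  \<open>m\<close>, \<open>T\<close> and \<open>H\<close> alone, not on the probability space or the
  process; the uniform constant of the theorem rests on this.\<close>

lemma fbm_sup_moment:
  fixes m :: nat and T H :: real
  assumes fbm: "fractional_brownian_motion M H B" and "0 < T" and mH: "1 < real m * H"
  obtains S where "S \<in> borel_measurable M"
    and "integrable M (\<lambda>\<omega>. S \<omega> ^ (2 * m))"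
    and "(\<integral>\<omega>. S \<omega> ^ (2 * m) \<partial>M) = fact (2 * m) / (2 ^ m * fact m) * T powr (2 * real m * H)
           / (1 - 2 powr (1 - real m * H)) / (1 - 2 powr (- H / 2)) ^ (2 * m)"
    and "AE \<omega> in M. \<forall>t\<in>{0..T}. \<bar>B t \<omega>\<bar> \<le> S \<omega>"
proof -
  interpret prob_space M
    using fbm by (simp add: fractional_brownian_motion_def)
  have H: "0 < H" using fbm by (simp add: fractional_brownian_motion_def)
  have m: "0 < m" using mH by (cases m) auto
  \<comment> \<open>Chaining with \<open>2 powr (- \<alpha>)\<close> works for every positive
    \<open>\<alpha>\<close> below \<open>H - 1 / (2 * m)\<close>, and \<open>1 < m * H\<close> says
    precisely that \<open>\<alpha> = H / 2\<close> is admissible. The weight \<open>w\<close> is the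
    reciprocal of \<open>\<rho> ^ (2 * m)\<close>.\<close>
  define \<rho> where "\<rho> = 2 powr (- H / 2)"
  define q where "q = 2 powr (1 - real m * H)"
  define w where "w = 2 powr (real m * H)"
  define K where "K = fact (2 * m) / (2 ^ m * fact m) * T powr (2 * real m * H)"
  have \<rho>: "0 < \<rho>" "\<rho> < 1"
    using H by (auto simp: \<rho>_def powr_less_one)
  have q: "0 < q" "q < 1"
    using mH by (auto simp: q_def powr_less_one)
  have w: "0 < w" by (simp add: w_def)
  have K: "0 \<le> K" by (simp add: K_def)
  have w_\<rho>: "w ^ n * (\<rho> ^ n) ^ (2 * m) = 1" for n
    by (simp add: w_def \<rho>_def powr_realpow[symmetric] powr_powr powr_add[symmetric] mult_ac)
  define d where "d n j \<omega> = B (T * real (Suc j) / 2 ^ n) \<omega> - B (T * real j / 2 ^ n) \<omega>" for n j :: nat and \<omega>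
  define V where "V n \<omega> = w ^ n * (\<Sum>j<2 ^ n. d n j \<omega> ^ (2 * m))" for n \<omega>
  \<comment> \<open>The weight \<open>w\<close> is small enough for \<open>U\<close> to be integrable, since \<open>\<integral>V n = K q\<^sup>n\<close>, and large
    enough for \<open>U\<close> to bound the level \<open>n\<close> increments by a multiple of \<open>\<rho>\<^sup>n\<close>.\<close>
  define U where "U \<omega> = (\<Sum>n. ennreal (V n \<omega>))" for \<omega>
  \<comment> \<open>\<open>enn2real\<close> sends \<infinity> to 0, so \<open>S\<close> is real
    everywhere, but the path bound is claimed only where \<open>U\<close> is finite.\<close>
  define S where "S \<omega> = root (2 * m) (enn2real (U \<omega>)) / (1 - \<rho>)" for \<omega>
  have B_meas: "B t \<in> borel_measurable M" if "0 \<le> t" for t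
    using gaussian_rv_measurable[OF fbm_gaussian[OF fbm that]] .
  have d_meas [measurable]: "d n j \<in> borel_measurable M" for n j
    unfolding d_def[abs_def] using \<open>0 < T\<close> by (intro borel_measurable_diff B_meas) auto
  have V_meas [measurable]: "V n \<in> borel_measurable M" for n
    unfolding V_def[abs_def] by measurable
  have U_meas [measurable]: "U \<in> borel_measurable M"
    unfolding U_def[abs_def] by measurable
  have S_meas: "S \<in> borel_measurable M"
    unfolding S_def[abs_def] by measurable
  have V_nonneg: "0 \<le> V n \<omega>" for n \<omega>
    unfolding V_def using w by (intro mult_nonneg_nonneg sum_nonneg) auto
  have d_moment: "integrable M (\<lambda>\<omega>. d n j \<omega> ^ (2 * m))"
    "(\<integral>\<omega>. d n j \<omega> ^ (2 * m) \<partial>M) = K * (1 / 2 ^ n) powr (2 * real m * H)" for n j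
  proof -
    have "\<bar>T * real (Suc j) / 2 ^ n - T * real j / 2 ^ n\<bar> = T * (1 / 2 ^ n)"
      using \<open>0 < T\<close> by (simp add: field_simps)
    then have *: "\<bar>T * real (Suc j) / 2 ^ n - T * real j / 2 ^ n\<bar> powr (2 * real m * H)
        = T powr (2 * real m * H) * (1 / 2 ^ n) powr (2 * real m * H)"
      using \<open>0 < T\<close> by (simp only: powr_mult)
    have "0 \<le> T * real j / 2 ^ n" "0 \<le> T * real (Suc j) / 2 ^ n"
      "T * real j / 2 ^ n \<noteq> T * real (Suc j) / 2 ^ n"
      using \<open>0 < T\<close> by auto
    note moment = fbm_increment_moment[OF fbm this m]
    from moment(1) show "integrable M (\<lambda>\<omega>. d n j \<omega> ^ (2 * m))"
      by (simp only: d_def)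
    from moment(2) show "(\<integral>\<omega>. d n j \<omega> ^ (2 * m) \<partial>M) = K * (1 / 2 ^ n) powr (2 * real m * H)"
      unfolding * by (simp only: d_def K_def mult.assoc)
  qed
  have V_int: "integrable M (V n)" for n
    unfolding V_def[abs_def] by (intro Bochner_Integration.integrable_mult_right Bochner_Integration.integrable_sum d_moment)
  have V_integral: "(\<integral>\<omega>. V n \<omega> \<partial>M) = K * q ^ n" for n
  proof -
    have "(\<integral>\<omega>. V n \<omega> \<partial>M) = K * (w ^ n * 2 ^ n * (1 / 2 ^ n) powr (2 * real m * H))"
      unfolding V_def using d_moment by simp
    \<comment> \<open>The \<open>2 ^ n\<close> increments of level \<open>n\<close> compete with the
      decay of each moment: per level the exponents of 2 add up to
      \<open>m * H + 1 - 2 * m * H = 1 - m * H\<close>.\<close>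
    also have "w ^ n * 2 ^ n * (1 / 2 ^ n) powr (2 * real m * H) = q ^ n"
    proof -
      have "(1 / 2 ^ n :: real) = 2 powr (- real n)"
        by (simp add: powr_minus_divide powr_realpow)
      moreover have "(2 ^ n :: real) = 2 powr (real n)"
        by (simp add: powr_realpow)
      ultimately show ?thesis
        by (simp add: w_def q_def powr_powr powr_power powr_add[symmetric] algebra_simps)
    qed
    finally show ?thesis .
  qed
  have "(\<integral>\<^sup>+\<omega>. U \<omega> \<partial>M) = (\<Sum>n. \<integral>\<^sup>+\<omega>. ennreal (V n \<omega>) \<partial>M)"
    unfolding U_def by (intro nn_integral_suminf) measurable
  also have "\<dots> = (\<Sum>n. ennreal (K * q ^ n))"
    using V_int V_nonneg V_integral by (simp add: nn_integral_eq_integral)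
  also have "\<dots> = ennreal (K / (1 - q))"
  proof -
    have "(\<lambda>n. K * q ^ n) sums (K * (1 / (1 - q)))"
      using q by (intro sums_mult geometric_sums) auto
    then show ?thesis
      using K q by (intro suminf_ennreal_eq) auto
  qed
  finally have U_integral: "(\<integral>\<^sup>+\<omega>. U \<omega> \<partial>M) = ennreal (K / (1 - q))" .
  then have U_finite: "AE \<omega> in M. U \<omega> \<noteq> \<infinity>"
    by (intro nn_integral_noteq_infinite) auto
  have S_power: "S \<omega> ^ (2 * m) = enn2real (U \<omega>) / (1 - \<rho>) ^ (2 * m)" for \<omega>
    unfolding S_def using m by (simp add: power_divide)
  have "(\<integral>\<^sup>+\<omega>. ennreal (enn2real (U \<omega>)) \<partial>M) = (\<integral>\<^sup>+\<omega>. U \<omega> \<partial>M)"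
    using U_finite by (intro nn_integral_cong_AE) (auto simp: less_top)
  then have "has_bochner_integral M (\<lambda>\<omega>. enn2real (U \<omega>)) (K / (1 - q))"
    using U_integral K q by (intro has_bochner_integral_nn_integral) auto
  then have S_moment: "integrable M (\<lambda>\<omega>. S \<omega> ^ (2 * m))"
    "(\<integral>\<omega>. S \<omega> ^ (2 * m) \<partial>M) = K / (1 - q) / (1 - \<rho>) ^ (2 * m)"
    unfolding S_power by (auto simp: has_bochner_integral_iff)
  have "AE \<omega> in M. \<forall>t\<in>{0..T}. \<bar>B t \<omega>\<bar> \<le> S \<omega>"
    using U_finite AE_space
  proof eventually_elim
    case (elim \<omega>)
    define A where "A = root (2 * m) (enn2real (U \<omega>))"
    have A: "0 \<le> A" "A ^ (2 * m) = enn2real (U \<omega>)"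
      using m by (auto simp: A_def)
    have incr: "\<bar>d n j \<omega>\<bar> \<le> A * \<rho> ^ n" if "j < 2 ^ n" for n j
    proof -
      \<comment> \<open>One increment is dominated by its level and the level by the whole series.
        Multiplying by \<open>(\<rho> ^ n) ^ (2 * m)\<close> cancels the weight before the root is
        taken.\<close>
      have "ennreal (V n \<omega>) \<le> U \<omega>"
        unfolding U_def using sum_le_suminf[of "\<lambda>n. ennreal (V n \<omega>)" "{n}"] by simp
      then have "V n \<omega> \<le> A ^ (2 * m)"
        unfolding A(2) using elim(1) V_nonneg by (metis enn2real_ennreal enn2real_mono infinity_ennreal_def less_top)
      moreover have "w ^ n * d n j \<omega> ^ (2 * m) \<le> V n \<omega>"
        unfolding V_def using w that
        by (intro mult_left_mono member_le_sum[of j "{..<2 ^ n}" "\<lambda>j. d n j \<omega> ^ (2 * m)"]) auto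
      ultimately have "(w ^ n * d n j \<omega> ^ (2 * m)) * (\<rho> ^ n) ^ (2 * m) \<le> A ^ (2 * m) * (\<rho> ^ n) ^ (2 * m)"
        using \<rho> by (intro mult_right_mono) auto
      moreover have "(w ^ n * d n j \<omega> ^ (2 * m)) * (\<rho> ^ n) ^ (2 * m) = \<bar>d n j \<omega>\<bar> ^ (2 * m)"
        using w_\<rho>[of n] by (simp add: power_even_abs mult.commute mult.left_commute)
      ultimately have "\<bar>d n j \<omega>\<bar> ^ (2 * m) \<le> (A * \<rho> ^ n) ^ (2 * m)"
        by (simp only: power_mult_distrib)
      then show ?thesis
        using A(1) \<rho> m by (subst (asm) power_mono_iff) auto
    qed
    have path: "continuous_on {0..} (\<lambda>t. B t \<omega>)" "B 0 \<omega> = 0"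
      using fbm elim(2) by (auto simp: fractional_brownian_motion_def)
    show ?case
    proof
      fix t assume "t \<in> {0..T}"
      then have "\<bar>B t \<omega>\<bar> \<le> A / (1 - \<rho>)"
        using \<open>0 < T\<close> A(1) \<rho> path incr[unfolded d_def]
        by (intro dyadic_bound[of T A \<rho>]) (auto intro: continuous_on_subset)
      then show "\<bar>B t \<omega>\<bar> \<le> S \<omega>" by (simp add: S_def A_def)
    qed
  qed
  with S_meas S_moment show thesis
    using that unfolding K_def q_def \<rho>_def by blast
qed

section \<open>From even integer moments to the real exponent, and the uniform bound\<close>

text \<open>The summand 1 takes care of arguments up to 1, where raising the exponent makes the
  power smaller.\<close>

lemma powr_le_one_add_power:
  fixes x r :: real
  assumes "0 \<le> x" "0 \<le> r" "r \<le> real n"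
  shows "x powr r \<le> 1 + x ^ n"
proof (cases "x \<le> 1")
  case True
  then have "x powr r \<le> 1 powr r"
    using assms by (intro powr_mono2) auto
  then show ?thesis using assms by (auto intro: add_increasing2)
next
  case False
  then have "x powr r \<le> x powr real n"
    using assms by (intro powr_mono) auto
  then show ?thesis using False by (simp add: powr_realpow)
qed

lemma power_add_le:
  fixes x y :: real
  assumes "0 \<le> x" "0 \<le> y"
  shows "(x + y) ^ n \<le> 2 ^ n * (x ^ n + y ^ n)"
proof -
  have "(x + y) ^ n \<le> (2 * max x y) ^ n"
    using assms by (intro power_mono) auto
  also have "\<dots> = 2 ^ n * max x y ^ n" by (rule power_mult_distrib)
  also have "max x y ^ n \<le> x ^ n + y ^ n"
    using assms by (auto simp: max_def)
  finally show ?thesis by simp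
qed

text \<open>\<open>C\<close> is quantified before the space, the noise and the solutions, so that it
  can depend on the real parameters only. Integrability is asserted separately because the Bochner
  integral of a nonintegrable function is 0, which would make the bound empty.\<close>

theorem corollary2p1:
  fixes T r Y0 k a \<sigma> H :: real
  assumes "0 < T" and "1 \<le> r"
    and "0 < Y0" and "0 < k" and "0 < a" and "0 < \<sigma>"
    and "0 < H" and "H < 1"
  shows "\<exists>C::real. \<forall>(M :: 'w measure) B Y.
           fractional_brownian_motion M H B \<and>
           (\<forall>\<epsilon>>0. approx_solution M B Y0 k a \<sigma> \<epsilon> (Y \<epsilon>)) \<longrightarrow>
           (\<forall>\<epsilon>>0. \<forall>t\<in>{0..T}.
              integrable M (\<lambda>\<omega>. \<bar>Y \<epsilon> t \<omega>\<bar> powr r) \<and>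
              (\<integral>\<omega>. \<bar>Y \<epsilon> t \<omega>\<bar> powr r \<partial>M) < C)"
proof -
  \<comment> \<open>\<open>m > 1 / H\<close> is what chaining requires; \<open>m > r\<close> puts
    \<open>r\<close> below the exponent \<open>2 * m\<close>.\<close>
  obtain m :: nat where m: "max r (1 / H) < real m"
    using reals_Archimedean2 by blast
  then have mH: "1 < real m * H"
    using \<open>0 < H\<close> by (simp add: field_simps)
  define c where "c = Y0 + k * T / Y0"
  define K where "K = fact (2 * m) / (2 ^ m * fact m) * T powr (2 * real m * H)
           / (1 - 2 powr (1 - real m * H)) / (1 - 2 powr (- H / 2)) ^ (2 * m)"
  define C where "C = 1 + 2 ^ (2 * m) * (c ^ (2 * m) + (2 * \<sigma>) ^ (2 * m) * K)"
  have c: "0 \<le> c" using assms by (simp add: c_def)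
  \<comment> \<open>The expectation is at most \<open>C\<close>; adding 1 makes the inequality
    strict.\<close>
  have "integrable M (\<lambda>\<omega>. \<bar>Y t \<omega>\<bar> powr r) \<and> (\<integral>\<omega>. \<bar>Y t \<omega>\<bar> powr r \<partial>M) < C + 1"
    if fbm: "fractional_brownian_motion M H B" and "0 < \<epsilon>"
      and sol: "approx_solution M B Y0 k a \<sigma> \<epsilon> Y" and t: "t \<in> {0..T}"
    for M :: "'w measure" and B Y \<epsilon> t
  proof -
    interpret prob_space M
      using fbm by (simp add: fractional_brownian_motion_def)
    obtain S where S: "integrable M (\<lambda>\<omega>. S \<omega> ^ (2 * m))" "(\<integral>\<omega>. S \<omega> ^ (2 * m) \<partial>M) = K"
      "AE \<omega> in M. \<forall>t\<in>{0..T}. \<bar>B t \<omega>\<bar> \<le> S \<omega>"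
      unfolding K_def by (rule fbm_sup_moment[OF fbm \<open>0 < T\<close> mH])
    \<comment> \<open>\<open>G\<close> is the integrable majorant obtained from the pathwise bound
      \<open>c + 2 * \<sigma> * S \<omega>\<close>; \<open>C\<close> is defined as its
      expectation.\<close>
    define G where "G \<omega> = 1 + 2 ^ (2 * m) * (c ^ (2 * m) + (2 * \<sigma>) ^ (2 * m) * S \<omega> ^ (2 * m))" for \<omega>
    have G: "integrable M G" "(\<integral>\<omega>. G \<omega> \<partial>M) = C"
      using S(1,2) by (simp_all add: G_def[abs_def] C_def prob_space)
    have Y [measurable]: "Y t \<in> borel_measurable M"
      using sol t by (simp add: approx_solution_def)
    have bound: "AE \<omega> in M. \<bar>Y t \<omega>\<bar> powr r \<le> G \<omega>"
      using S(3) AE_space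
    proof eventually_elim
      case (elim \<omega>)
      have "0 \<le> S \<omega>" using elim(1) t by fastforce
      have "\<bar>Y t \<omega>\<bar> \<le> c + 2 * \<sigma> * S \<omega>"
        unfolding c_def
      proof (rule solution_bound[of Y0 k a \<sigma> \<epsilon> "\<lambda>t. Y t \<omega>" "\<lambda>t. B t \<omega>"])
        show "B 0 \<omega> = 0"
          using fbm elim(2) by (simp add: fractional_brownian_motion_def)
      qed (use assms \<open>0 < \<epsilon>\<close> sol elim t in \<open>auto simp: approx_solution_def\<close>)
      then have "\<bar>Y t \<omega>\<bar> ^ (2 * m) \<le> (c + 2 * \<sigma> * S \<omega>) ^ (2 * m)"
        by (intro power_mono) auto
      also have "\<dots> \<le> 2 ^ (2 * m) * (c ^ (2 * m) + (2 * \<sigma> * S \<omega>) ^ (2 * m))"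
        using c \<open>0 \<le> S \<omega>\<close> \<open>0 < \<sigma>\<close> by (intro power_add_le) auto
      finally have "1 + \<bar>Y t \<omega>\<bar> ^ (2 * m) \<le> G \<omega>"
        by (simp add: G_def power_mult_distrib)
      moreover have "\<bar>Y t \<omega>\<bar> powr r \<le> 1 + \<bar>Y t \<omega>\<bar> ^ (2 * m)"
        using \<open>1 \<le> r\<close> m by (intro powr_le_one_add_power) auto
      ultimately show ?case by linarith
    qed
    have int: "integrable M (\<lambda>\<omega>. \<bar>Y t \<omega>\<bar> powr r)"
      by (rule Bochner_Integration.integrable_bound[OF G(1)]) (use bound in auto)
    with integral_mono_AE[OF int G(1) bound] G(2) show ?thesis by simp
  qed
  then show ?thesis by (intro exI[of _ "C + 1"]) blast
qed

end
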